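(* Let $f\in C^2(\mathbb{R})$ satisfy $f(u)>0$, $f'(u)\ge 0$ and $f''(u)>0$ for all $u$, and $\lim_{u\to\infty}f(u)/u=\infty$. Let $\alpha>0$ and $L_0>0$ be given, and let $\lambda(C)$, $C>0$, be the function defined in the context. Then there exists $C^*>0$ such that $\lambda(C)$ is increasing in $(0,C^* )$ and decreasing in $(C^*,\infty)$. Moreover $\lambda(0)=0$, $\lambda(\infty)=0$ (as limits for $C\to 0$ and $C\to\infty$), and $\lambda(C^* )=\lambda^*$.
   Context: Set $F(u)=\int_0^u f(t)\,dt$ with inverse $F^{-1}:[0,\infty)\to[0,\infty)$. For $C>0$ and $\lambda>0$ let $v_1=v_1(C,\lambda)>0$ be the unique positive solution of $F\left(\frac{\sqrt{\lambda}}{\alpha}v_1\right)+\frac{v_1^2}{2}=C$ and set $$L(C;\lambda,\alpha)=2\int_0^{v_1}\frac{dv}{\sqrt{\lambda}\,f\left(F^{-1}\left(C-\frac{v^2}{2}\right)\right)}.$$ For fixed $C,\alpha$ this is strictly decreasing in $\lambda$. For the fixed length $L_0$, $\lambda(C)$ denotes the value $\lambda>0$ determined by $L(C;\lambda,\alpha)=L_0$, i.e. implicitly by $\sqrt{\lambda(C)}=2\int_0^{v_1}\frac{dv}{L_0 f(F^{-1}(C-v^2/2))}$ with $v_1=v_1(C,\lambda(C))$. The number $\lambda^*\in(0,\infty)$ is the critical value such that the problem $u''+\lambda f(u)=0$ in $(0,L_0)$, $u'(0)=\alpha u(0)$, $u'(L_0)=-\alpha u(L_0)$ has a solution for every $0<\lambda\le\lambda^*$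 and no solution for $\lambda>\lambda^*$. *)

theory Defs
  imports "HOL-Analysis.Analysis"
begin

definition Fprim :: "(real \<Rightarrow> real) \<Rightarrow> real \<Rightarrow> real" where
  "Fprim f u = (LBINT t=0..u. f t)"

definition Finv :: "(real \<Rightarrow> real) \<Rightarrow> real \<Rightarrow> real" where
  "Finv f = inv_into {0..} (Fprim f)"

definition v1 :: "(real \<Rightarrow> real) \<Rightarrow> real \<Rightarrow> real \<Rightarrow> real \<Rightarrow> real" where
  "v1 f \<alpha> C \<mu> = (THE v. v > 0 \<and> Fprim f (sqrt \<mu> / \<alpha> * v) + v\<^sup>2 / 2 = C)"

text \<open>In the phase plane \<open>(u, u' / sqrt \<mu>)\<close> the trajectories of \<open>u'' + \<mu> f(u) = 0\<close> are the
  level sets \<open>F(u) + v\<^sup>2 / 2 = C\<close>; the following is the length of the interval on which the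
  trajectory joins the two lines given by the boundary conditions.\<close>

definition len :: "(real \<Rightarrow> real) \<Rightarrow> real \<Rightarrow> real \<Rightarrow> real \<Rightarrow> real" where
  "len f \<alpha> C \<mu> =
     2 * (LBINT v=0..v1 f \<alpha> C \<mu>. 1 / (sqrt \<mu> * f (Finv f (C - v\<^sup>2 / 2))))"

definition lambda_of :: "(real \<Rightarrow> real) \<Rightarrow> real \<Rightarrow> real \<Rightarrow> real \<Rightarrow> real" where
  "lambda_of f \<alpha> L0 C = (THE \<mu>. \<mu> > 0 \<and> len f \<alpha> C \<mu> = L0)"

text \<open>Classical solutions: \<open>C\<^sup>1\<close> up to the boundary, with one-sided derivatives at the endpoints,
  and twice differentiable inside (then \<open>C\<^sup>2\<close> inside, by the equation, when \<open>f\<close> is continuous).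
  Values of \<open>u\<close> outside \<open>[0, L0]\<close> are irrelevant.\<close>

definition bvp_solution ::
  "(real \<Rightarrow> real) \<Rightarrow> real \<Rightarrow> real \<Rightarrow> real \<Rightarrow> (real \<Rightarrow> real) \<Rightarrow> bool" where
  "bvp_solution f \<alpha> L0 \<mu> u \<longleftrightarrow>
     (\<exists>u'. (\<forall>x\<in>{0..L0}. (u has_real_derivative u' x) (at x within {0..L0})) \<and>
           continuous_on {0..L0} u' \<and>
           (\<forall>x\<in>{0<..<L0}. \<exists>u''. (u' has_real_derivative u'') (at x) \<and> u'' + \<mu> * f (u x) = 0) \<and>
           u' 0 = \<alpha> * u 0 \<and> u' L0 = - \<alpha> * u L0)"

definition is_critical :: "(real \<Rightarrow> real) \<Rightarrow> real \<Rightarrow> real \<Rightarrow> real \<Rightarrow> bool" where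
  "is_critical f \<alpha> L0 \<nu> \<longleftrightarrow>
     \<nu> > 0 \<and>
     (\<forall>\<mu>. 0 < \<mu> \<and> \<mu> \<le> \<nu> \<longrightarrow> (\<exists>u. bvp_solution f \<alpha> L0 \<mu> u)) \<and>
     (\<forall>\<mu>. \<mu> > \<nu> \<longrightarrow> \<not> (\<exists>u. bvp_solution f \<alpha> L0 \<mu> u))"

definition lambda_star :: "(real \<Rightarrow> real) \<Rightarrow> real \<Rightarrow> real \<Rightarrow> real" where
  "lambda_star f \<alpha> L0 = (THE \<nu>. is_critical f \<alpha> L0 \<nu>)"

end

theory Submission
  imports Defs
begin

text \<open>
  A solution of the boundary value problem is symmetric about the midpoint of the interval.
  In the rescaled time \<open>s = sqrt \<mu> * (x - L0 / 2)\<close> and with \<open>v = - du/ds\<close> it becomes the orbit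
  \<open>p' = - v\<close>, \<open>v' = f p\<close> that starts at its maximum with \<open>v = 0\<close>. Its energy \<open>C\<close> determines the
  orbit, which no longer depends on \<open>\<mu>\<close>: the parameter enters only through the time
  \<open>S = sqrt \<mu> * L0 / 2\<close> and the exit condition \<open>p S = sqrt \<mu> / \<alpha> * v S\<close>. The
  equation \<open>len f \<alpha> C \<mu> = L0\<close> says that the orbit of energy \<open>C\<close> meets the exit line at time \<open>S\<close>.
  Hence the parameters for which the problem is solvable are exactly the values of \<open>lambda_of\<close>
  (\<open>bvp_solvable_iff\<close>).

  The heart of the proof is that \<open>lambda_of\<close> takes no value three times
  (\<open>no_three_orbits\<close>). Three energies with the same parameter give three solutions, and these
  are ordered, \<open>p1 < p2 < p3\<close>, because at an interior minimum of the difference of two of them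
  the velocities agree, so that the energies decide which is higher (\<open>orbits_ordered\<close>). The
  positive functions \<open>p2 - p1\<close> and \<open>p3 - p2\<close> solve linear equations \<open>w'' + q w = 0\<close> whose
  potentials are the slopes of the secants of \<open>f\<close>; by strict convexity the second potential is
  larger. Since both functions satisfy the same homogeneous boundary conditions, their Wronskian
  vanishes at both ends, but it is strictly monotone.

  Next, \<open>lambda_of\<close> is continuous, because \<open>len\<close> is continuous and strictly decreasing in \<open>\<mu>\<close>,
  and it tends to \<open>0\<close> at both ends: concavity of the solution gives
  \<open>\<mu> < 16 M / (L0\<^sup>2 * f (M / 2))\<close>, where \<open>M\<close> is its maximum (\<open>parameter_bound\<close>). A positive
  continuous function on the half-line with limit \<open>0\<close> at both ends that takes no value three times
  is unimodal, by the intermediate value theorem (\<open>unimodal_of_no_level_thrice\<close>). It then takes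
  exactly the values in \<open>{0<..m}\<close>, where \<open>m\<close> is its maximum; by the first paragraph, \<open>m\<close> is the
  critical parameter.
\<close>

section \<open>Calculus on the real line\<close>

lemma interval_integral_from_0_has_real_derivative:
  fixes q :: "real \<Rightarrow> real"
  assumes q: "continuous_on UNIV q"
  shows "((\<lambda>u. LBINT t=0..u. q t) has_real_derivative q x) (at x)"
proof -
  let ?a = "- \<bar>x\<bar> - 1" and ?b = "\<bar>x\<bar> + 1"
  have "((\<lambda>u. LBINT t=(0::real)..u. q t) has_vector_derivative q x) (at x within {?a..?b})"
    by (rule interval_integral_FTC2) (auto intro: continuous_on_subset[OF q])
  moreover have "at x within {?a..?b} = at x"
    by (rule at_within_interior) auto
  ultimately show ?thesis
    by (simp add: has_real_derivative_iff_has_vector_derivative zero_ereal_def)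
qed

text \<open>The lower bound on the derivative forces \<open>h\<close> to run through all reals, so that the inverse is
  defined and differentiable everywhere. It serves twice: for the primitive of the nonlinearity and
  for the time along an orbit.\<close>
lemma real_bijection_of_derivative_bounded_below:
  fixes h h' :: "real \<Rightarrow> real"
  assumes h: "\<And>x. (h has_real_derivative h' x) (at x)" and c: "c > 0" "\<And>x. h' x \<ge> c"
  shows "strict_mono h" "bij h" "(inv h has_real_derivative 1 / h' (inv h t)) (at t)"
proof -
  show sm: "strict_mono h"
  proof (rule strict_monoI)
    fix x y :: real assume "x < y"
    moreover have "\<exists>d. DERIV h z :> d \<and> 0 < d" for z
      using h[of z] c(1) c(2)[of z] by (intro exI[of _ "h' z"]) auto
    ultimately show "h x < h y" using DERIV_pos_imp_increasing by blast
  qed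
  have cont: "continuous_on A h" for A
    using h by (meson DERIV_isCont continuous_at_imp_continuous_on)
  have grow: "h b - h a \<ge> c * (b - a)" if ab: "a \<le> b" for a b
  proof (cases "a < b")
    case True
    then obtain z where "h b - h a = (b - a) * h' z"
      using MVT2[of a b h h'] h by blast
    then show ?thesis using c(2)[of z] True by (simp add: mult.commute mult_left_mono)
  qed (use ab in auto)
  have "\<exists>x. h x = y" for y
  proof -
    let ?n = "\<bar>y - h 0\<bar> / c"
    have n: "?n \<ge> 0" "c * ?n = \<bar>y - h 0\<bar>" using c by auto
    have "h ?n - h 0 \<ge> \<bar>y - h 0\<bar>" "h 0 - h (-?n) \<ge> \<bar>y - h 0\<bar>"
      using grow[of 0 ?n] grow[of "-?n" 0] n by simp_all
    then show ?thesis
      using IVT'[of h "-?n" y ?n] n cont by force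
  qed
  then show bij: "bij h"
    using sm by (metis bij_def strict_mono_imp_inj_on surj_def)
  have inv: "inv h (h x) = x" "h (inv h y) = y" for x y
    using bij by (simp_all add: bij_is_inj bij_is_surj surj_f_inv_f)
  have "isCont (inv h) (h (inv h t))"
    by (rule isCont_inverse_function[where d = 1]) (use h in \<open>auto simp: inv intro: DERIV_isCont\<close>)
  then have "isCont (inv h) t" by (simp add: inv)
  then have "DERIV (inv h) t :> inverse (h' (inv h t))"
    by (intro DERIV_inverse_function[where f = h and a = "t - 1" and b = "t + 1"])
      (use h c(1) c(2)[of "inv h t"] in \<open>auto simp: inv\<close>)
  then show "(inv h has_real_derivative 1 / h' (inv h t)) (at t)"
    by (simp add: inverse_eq_divide)
qed

text \<open>Continuity of an implicitly defined function without an implicit function theorem: the sign of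
  \<open>Phi x y\<close> tells whether \<open>y\<close> lies below or above the root, and this sign persists under small
  changes of \<open>x\<close>.\<close>
lemma continuous_on_positive_root:
  fixes Phi :: "'a::topological_space \<Rightarrow> real \<Rightarrow> real" and r :: "'a \<Rightarrow> real"
  assumes pos: "\<And>x. x \<in> S \<Longrightarrow> r x > 0"
    and below: "\<And>x y. x \<in> S \<Longrightarrow> 0 < y \<Longrightarrow> y < r x \<Longrightarrow> Phi x y < 0"
    and above: "\<And>x y. x \<in> S \<Longrightarrow> r x < y \<Longrightarrow> Phi x y > 0"
    and root: "\<And>x. x \<in> S \<Longrightarrow> Phi x (r x) = 0"
    and cont: "\<And>y. 0 < y \<Longrightarrow> continuous_on S (\<lambda>x. Phi x y)"
  shows "continuous_on S r"
  unfolding continuous_on_def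
proof (intro ballI order_tendstoI)
  fix x a assume x: "x \<in> S"
  have S: "\<forall>\<^sub>F z in at x within S. z \<in> S"
    by (simp add: eventually_at_topological) blast
  have lim: "((\<lambda>z. Phi z y) \<longlongrightarrow> Phi x y) (at x within S)" if "0 < y" for y
    using cont[OF that] x by (simp add: continuous_on_def)
  {
    assume a: "a < r x"
    show "\<forall>\<^sub>F z in at x within S. a < r z"
    proof (cases "0 < a")
      case True
      have "\<forall>\<^sub>F z in at x within S. Phi z a < 0"
        using order_tendstoD(2)[OF lim] below x a True by blast
      then show ?thesis using S
        by eventually_elim (use above root in \<open>metis linorder_neqE order_less_asym less_irrefl\<close>)
    next
      case False
      show ?thesis using S by eventually_elim (use False pos in force)
    qed
  }
  {
    assume a: "r x < a"
    show "\<forall>\<^sub>F z in at x within S. r z < a"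
    proof -
      have a0: "0 < a" using pos[OF x] a by simp
      have "\<forall>\<^sub>F z in at x within S. Phi z a > 0"
        using order_tendstoD(1)[OF lim] above x a a0 by blast
      then show ?thesis using S
        by eventually_elim (use below root a0 in \<open>metis linorder_neqE order_less_asym less_irrefl\<close>)
    qed
  }
qed

text \<open>If \<open>g\<close> failed to increase between \<open>x < y\<close> to the left of its maximum point \<open>p\<close>, the value
  \<open>g y\<close> would be taken in \<open>{0<..x}\<close>, at \<open>y\<close>, and once more in \<open>{p..}\<close>.\<close>
lemma unimodal_of_no_level_thrice:
  fixes g :: "real \<Rightarrow> real"
  assumes cont: "continuous_on {0<..} g" and pos: "\<And>x. x > 0 \<Longrightarrow> g x > 0"
    and lim0: "(g \<longlongrightarrow> 0) (at_right 0)" and lim_inf: "(g \<longlongrightarrow> 0) at_top"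
    and twice: "\<And>a b c. 0 < a \<Longrightarrow> a < b \<Longrightarrow> b < c \<Longrightarrow> g a = g b \<Longrightarrow> g b = g c \<Longrightarrow> False"
  obtains p where "p > 0" "strict_mono_on {0<..<p} g" "strict_antimono_on {p<..} g"
    "g ` {0<..} = {0<..g p}"
proof -
  have low_left: "\<exists>x. 0 < x \<and> x < b \<and> g x < e" if "0 < b" "0 < e" for b e
  proof -
    have "\<forall>\<^sub>F x in at_right 0. g x < e" using order_tendstoD(2)[OF lim0] that by blast
    moreover have "\<forall>\<^sub>F x in at_right 0. x \<in> {0<..<b}"
      using that eventually_at_right_real by blast
    ultimately have "\<forall>\<^sub>F x in at_right 0. 0 < x \<and> x < b \<and> g x < e"
      by eventually_elim auto
    then show ?thesis using eventually_happens' trivial_limit_at_right_real by blast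
  qed
  have low_right: "\<exists>x>b. g x < e" if "0 < e" for b e
  proof -
    have "\<forall>\<^sub>F x in at_top. g x < e" using order_tendstoD(2)[OF lim_inf] that by blast
    moreover have "\<forall>\<^sub>F x in at_top. x > b" by (rule eventually_gt_at_top)
    ultimately have "\<forall>\<^sub>F x in at_top. x > b \<and> g x < e" by eventually_elim auto
    then show ?thesis using eventually_happens' trivial_limit_at_top_linorder by blast
  qed
  have cont': "continuous_on {a..b} g" if "0 < a" for a b
    by (rule continuous_on_subset[OF cont]) (use that in auto)
  have level_left: "\<exists>x. 0 < x \<and> x \<le> b \<and> g x = l" if bl: "0 < b" "0 < l" "l \<le> g b" for b l
  proof -
    obtain a where "0 < a" "a < b" "g a < l" using low_left[OF bl(1,2)] by blast
    then obtain x where "a \<le> x" "x \<le> b" "g x = l"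
      using IVT'[of g a l b] bl cont'[of a b] by auto
    then show ?thesis using \<open>0 < a\<close> by (intro exI[of _ x]) auto
  qed
  have level_right: "\<exists>x\<ge>b. g x = l" if bl: "0 < b" "0 < l" "l \<le> g b" for b l
  proof -
    obtain a where "b < a" "g a < l" using low_right[OF bl(2)] by blast
    then obtain x where "b \<le> x" "x \<le> a" "g x = l"
      using IVT2'[of g a l b] bl cont'[of b a] by auto
    then show ?thesis by blast
  qed
  have g1: "g 1 > 0" using pos by simp
  \<comment> \<open>Outside a compact interval around \<open>1\<close> the values stay below \<open>g 1\<close>, so a maximum exists.\<close>
  obtain a where a: "0 < a" "a < 1" "\<And>x. 0 < x \<Longrightarrow> x < a \<Longrightarrow> g x < g 1"
  proof -
    have "\<forall>\<^sub>F x in at_right 0. g x < g 1" using order_tendstoD(2)[OF lim0] g1 by blast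
    then obtain d where "d > 0" "\<And>x. 0 < x \<Longrightarrow> x < d \<Longrightarrow> g x < g 1"
      by (auto simp: eventually_at_right_field)
    then show ?thesis using that[of "min d (1/2)"] by auto
  qed
  obtain b where b: "1 < b" "\<And>x. b \<le> x \<Longrightarrow> g x < g 1"
  proof -
    have "\<forall>\<^sub>F x in at_top. g x < g 1" using order_tendstoD(2)[OF lim_inf] g1 by blast
    then obtain d where "\<And>x. d \<le> x \<Longrightarrow> g x < g 1"
      by (auto simp: eventually_at_top_linorder)
    then show ?thesis using that[of "max d 2"] by auto
  qed
  obtain p where p: "p \<in> {a..b}" and pmax: "\<And>x. x \<in> {a..b} \<Longrightarrow> g x \<le> g p"
    using continuous_attains_sup[of "{a..b}" g] cont'[OF a(1)] a b by auto
  have p0: "p > 0" using p a by auto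
  have "g 1 \<le> g p" using pmax a b by auto
  then have top: "g x \<le> g p" if "x > 0" for x
  proof -
    consider "x < a" | "x > b" | "x \<in> {a..b}" by force
    then show ?thesis using pmax[of x] a(3)[of x] b(2)[of x] that \<open>g 1 \<le> g p\<close> by cases auto
  qed
  have incr: "strict_mono_on {0<..<p} g"
  proof (intro monotone_onI, rule ccontr)
    fix x y assume xy: "x \<in> {0<..<p}" "y \<in> {0<..<p}" "x < y" and nl: "\<not> g x < g y"
    obtain x' where "0 < x'" "x' \<le> x" "g x' = g y"
      using level_left[of x "g y"] nl xy pos[of y] by auto
    moreover obtain z where "z \<ge> p" "g z = g y"
      using level_right[of p "g y"] top[of y] pos[of y] p0 xy by auto
    ultimately show False by (intro twice[of x' y z]) (use xy in simp_all)
  qed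
  have decr: "strict_antimono_on {p<..} g"
  proof (intro monotone_onI, rule ccontr)
    fix x y assume xy: "x \<in> {p<..}" "y \<in> {p<..}" "x < y" and nl: "\<not> g x > g y"
    obtain x' where "0 < x'" "x' \<le> p" "g x' = g x"
      using level_left[of p "g x"] top[of x] pos[of x] p0 xy by auto
    moreover obtain z where "z \<ge> y" "g z = g x"
      using level_right[of y "g x"] nl pos[of x] p0 xy by auto
    ultimately show False by (intro twice[of x' x z]) (use xy in simp_all)
  qed
  have "g ` {0<..} = {0<..g p}"
  proof
    show "g ` {0<..} \<subseteq> {0<..g p}" using top pos by auto
    show "{0<..g p} \<subseteq> g ` {0<..}"
    proof
      fix l assume "l \<in> {0<..g p}"
      then obtain x where "0 < x" "g x = l" using level_left[OF p0, of l] by auto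
      then show "l \<in> g ` {0<..}" by auto
    qed
  qed
  then show ?thesis using that p0 incr decr by blast
qed

section \<open>The nonlinearity and its primitive\<close>

locale robin_problem =
  fixes f f' f'' :: "real \<Rightarrow> real" and \<alpha> L0 :: real
  assumes f_deriv: "(f has_real_derivative f' u) (at u)"
    and f'_deriv: "(f' has_real_derivative f'' u) (at u)"
    and f_pos: "f u > 0"
    and f'_nonneg: "f' u \<ge> 0"
    and f''_pos: "f'' u > 0"
    and superlinear: "filterlim (\<lambda>u. f u / u) at_top at_top"
    and alpha_pos: "\<alpha> > 0"
    and L0_pos: "L0 > 0"
begin

lemma f_mono: "x \<le> y \<Longrightarrow> f x \<le> f y"
  using DERIV_nonneg_imp_nondecreasing[of x y f] f_deriv f'_nonneg by blast

lemma f'_strict_mono: "x < y \<Longrightarrow> f' x < f' y"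
  using DERIV_pos_imp_increasing[of x y f'] f'_deriv f''_pos by blast

text \<open>The primitive of \<open>f\<close> need not be onto the reals (\<open>f = exp\<close> is an example). Freezing \<open>f\<close> below
  \<open>0\<close> keeps it away from \<open>0\<close>, and the primitive becomes a bijection of the reals. Inverse
  and orbits are then defined globally, and solutions of the boundary value problem, being
  nonnegative, do not notice the change.\<close>
definition f_ext :: "real \<Rightarrow> real" where
  "f_ext u = f (max u 0)"

definition F_ext :: "real \<Rightarrow> real" where
  "F_ext u = (LBINT t=0..u. f_ext t)"

text \<open>The maximal height of an orbit of energy \<open>y\<close>.\<close>
definition height :: "real \<Rightarrow> real" where
  "height = inv F_ext"

lemma f_ext_eq: "u \<ge> 0 \<Longrightarrow> f_ext u = f u"
  by (simp add: f_ext_def max_def)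

lemma f_ext_ge: "f_ext u \<ge> f 0"
  by (simp add: f_ext_def f_mono)

lemma f_ext_pos: "f_ext u > 0"
  by (simp add: f_ext_def f_pos)

lemma f_ext_mono: "x \<le> y \<Longrightarrow> f_ext x \<le> f_ext y"
  unfolding f_ext_def by (rule f_mono) auto

lemma continuous_f_ext:
  assumes "continuous_on A a"
  shows "continuous_on A (\<lambda>x. f_ext (a x))"
proof -
  have "continuous_on UNIV f"
    using f_deriv by (meson DERIV_isCont continuous_at_imp_continuous_on)
  then show ?thesis
    unfolding f_ext_def
    by (rule continuous_on_compose2) (use assms in \<open>auto intro!: continuous_intros\<close>)
qed

lemma F_ext_deriv: "(F_ext has_real_derivative f_ext x) (at x)"
  unfolding F_ext_def[abs_def]
  by (rule interval_integral_from_0_has_real_derivative) (intro continuous_f_ext continuous_on_id)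

lemma F_ext_0: "F_ext 0 = 0"
  by (simp add: F_ext_def zero_ereal_def)

lemmas F_ext_bijection =
  real_bijection_of_derivative_bounded_below[OF F_ext_deriv f_pos[of 0] f_ext_ge]

lemma F_ext_less_iff: "F_ext x < F_ext y \<longleftrightarrow> x < y"
  using F_ext_bijection(1) by (rule strict_mono_less)

lemma F_height: "F_ext (height y) = y"
  unfolding height_def using F_ext_bijection(2) by (simp add: bij_is_surj surj_f_inv_f)

lemma height_F: "height (F_ext u) = u"
  unfolding height_def using F_ext_bijection(2) by (simp add: bij_is_inj)

lemma height_less_iff: "height x < height y \<longleftrightarrow> x < y"
  using F_ext_less_iff[of "height x" "height y"] by (simp add: F_height)

lemma height_0: "height 0 = 0"
  using height_F[of 0] by (simp add: F_ext_0)

lemma height_pos: "y > 0 \<Longrightarrow> height y > 0"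
  using height_less_iff[of 0 y] by (simp add: height_0)

lemma height_deriv: "(height has_real_derivative 1 / f_ext (height y)) (at y)"
  unfolding height_def by (rule F_ext_bijection(3))

lemma continuous_F_ext:
  assumes "continuous_on A a"
  shows "continuous_on A (\<lambda>x. F_ext (a x))"
proof (rule continuous_on_compose2[of UNIV F_ext])
  show "continuous_on UNIV F_ext"
    using F_ext_deriv by (meson DERIV_isCont continuous_at_imp_continuous_on)
qed (use assms in auto)

lemma continuous_height:
  assumes "continuous_on A a"
  shows "continuous_on A (\<lambda>x. height (a x))"
proof (rule continuous_on_compose2[of UNIV height])
  show "continuous_on UNIV height"
    using height_deriv by (meson DERIV_isCont continuous_at_imp_continuous_on)
qed (use assms in auto)

lemma Fprim_eq: "u \<ge> 0 \<Longrightarrow> Fprim f u = F_ext u"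
  unfolding Fprim_def F_ext_def
  by (intro interval_integral_cong) (auto simp: einterval_iff f_ext_eq zero_ereal_def)

lemma Finv_eq:
  assumes "y \<ge> 0" shows "Finv f y = height y"
  unfolding Finv_def
proof (rule inv_into_f_eq)
  show h: "height y \<in> {0..}"
    using assms height_less_iff[of y 0] by (auto simp: height_0 not_less)
  show "inj_on (Fprim f) {0..}"
    using height_F by (auto intro!: inj_onI simp: Fprim_eq) metis
  show "Fprim f (height y) = y"
    using h by (simp add: Fprim_eq F_height)
qed

section \<open>The time along an orbit as a function of its velocity\<close>

text \<open>The reciprocal of \<open>dv/ds = f p\<close>, with \<open>p\<close> expressed through the velocity \<open>w\<close> by conservation of
  the energy \<open>C\<close>.\<close>
definition slowness :: "real \<Rightarrow> real \<Rightarrow> real" where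
  "slowness C w = 1 / f_ext (height (C - w\<^sup>2 / 2))"

definition travel_time :: "real \<Rightarrow> real \<Rightarrow> real" where
  "travel_time C v = (LBINT w=0..v. slowness C w)"

lemma continuous_slowness:
  assumes "continuous_on A a" "continuous_on A b"
  shows "continuous_on A (\<lambda>x. slowness (a x) (b x))"
  unfolding slowness_def
  by (intro continuous_on_divide continuous_on_const continuous_f_ext continuous_height
      continuous_intros assms) (use f_ext_pos in \<open>simp_all add: less_imp_neq[symmetric]\<close>)

lemma slowness_pos: "slowness C w > 0"
  by (simp add: slowness_def f_ext_pos)

lemma slowness_ge: "slowness C w \<ge> 1 / f_ext (height C)"
proof -
  have "height (C - w\<^sup>2 / 2) \<le> height C"
    using height_less_iff[of C "C - w\<^sup>2 / 2"] by (force simp: not_less)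
  then show ?thesis
    by (auto simp: slowness_def intro!: frac_le f_ext_mono f_ext_pos)
qed

lemma slowness_le: "slowness C w \<le> 1 / f 0"
  by (auto simp: slowness_def intro!: frac_le f_ext_ge f_pos)

lemma travel_time_deriv: "(travel_time C has_real_derivative slowness C v) (at v)"
  unfolding travel_time_def[abs_def]
  by (intro interval_integral_from_0_has_real_derivative continuous_slowness continuous_intros)

lemmas travel_time_bijection =
  real_bijection_of_derivative_bounded_below[OF travel_time_deriv
    divide_pos_pos[OF zero_less_one f_ext_pos] slowness_ge]

lemma travel_time_less_iff: "travel_time C x < travel_time C y \<longleftrightarrow> x < y"
  using travel_time_bijection(1) by (rule strict_mono_less)

lemma travel_time_0: "travel_time C 0 = 0"
  by (simp add: travel_time_def zero_ereal_def)

lemma travel_time_pos: "v > 0 \<Longrightarrow> travel_time C v > 0"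
  using travel_time_less_iff[of C 0 v] by (simp add: travel_time_0)

lemma travel_time_minus: "travel_time C (- v) = - travel_time C v"
proof -
  have "travel_time C (- v) = (LBINT w=v..0. slowness C (- w))"
    unfolding travel_time_def by (subst interval_integral_reflect) simp
  also have "\<dots> = (LBINT w=v..0. slowness C w)"
    by (simp add: slowness_def)
  also have "\<dots> = - travel_time C v"
    unfolding travel_time_def by (rule interval_integral_endpoints_reverse)
  finally show ?thesis .
qed

lemma travel_time_le:
  assumes "v \<ge> 0" shows "travel_time C v \<le> v / f 0"
proof -
  have "travel_time C v - v / f 0 \<le> travel_time C 0 - 0 / f 0"
  proof (rule DERIV_nonpos_imp_nonincreasing[OF assms])
    fix x
    have "((\<lambda>v. travel_time C v - v / f 0) has_real_derivative slowness C x - 1 / f 0) (at x)"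
      by (intro DERIV_diff travel_time_deriv DERIV_cdivide DERIV_ident)
    then show "\<exists>y. ((\<lambda>v. travel_time C v - v / f 0) has_real_derivative y) (at x) \<and> y \<le> 0"
      using slowness_le[of C x] by (intro exI conjI) auto
  qed
  then show ?thesis by (simp add: travel_time_0)
qed

text \<open>Over a fixed interval of integration, continuity in both arguments is a standard fact on
  parameter integrals.\<close>
lemma travel_time_eq_integral:
  "travel_time C v = v * integral {0..1} (\<lambda>s. slowness C (v * s))"
proof -
  have cont: "continuous_on A (\<lambda>s. slowness C (v * s))" for A
    by (intro continuous_slowness continuous_intros)
  have "(LBINT s=(0::real)..(1::real). v *\<^sub>R slowness C (v * s)) = (LBINT w=ereal (v * 0)..ereal (v * 1). slowness C w)"
    by (rule interval_integral_substitution_finite)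
      (auto intro!: derivative_eq_intros continuous_slowness continuous_intros)
  then have "travel_time C v = v * (LBINT s=(0::real)..(1::real). slowness C (v * s))"
    by (simp add: travel_time_def zero_ereal_def)
  also have "(LBINT s=(0::real)..(1::real). slowness C (v * s)) = integral {0..1} (\<lambda>s. slowness C (v * s))"
    by (rule interval_integral_eq_integral) (auto intro: borel_integrable_atLeastAtMost' cont)
  finally show ?thesis .
qed

lemma continuous_travel_time:
  assumes a: "continuous_on A a" and b: "continuous_on A b"
  shows "continuous_on A (\<lambda>x. travel_time (a x) (b x))"
proof -
  have "continuous_on (UNIV \<times> cbox 0 1) (\<lambda>(p, s). slowness (fst p) (snd p * s))"
    unfolding case_prod_unfold by (intro continuous_slowness continuous_intros)
  then have "continuous_on UNIV (\<lambda>p. integral (cbox 0 1) (\<lambda>s. slowness (fst p) (snd p * s)))"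
    by (rule integral_continuous_on_param)
  then have "continuous_on UNIV (\<lambda>p. travel_time (fst p) (snd p))"
    unfolding travel_time_eq_integral by (intro continuous_intros) (simp add: cbox_interval)
  then have "continuous_on A (\<lambda>x. (\<lambda>p. travel_time (fst p) (snd p)) (a x, b x))"
    by (rule continuous_on_compose2) (auto intro!: continuous_intros a b)
  then show ?thesis by simp
qed

section \<open>The exit velocity\<close>

text \<open>The energy of the orbit that meets the line \<open>p = sqrt \<mu> / \<alpha> * v\<close> of the boundary condition with
  velocity \<open>v\<close>.\<close>
definition exit_energy :: "real \<Rightarrow> real \<Rightarrow> real" where
  "exit_energy \<mu> v = F_ext (sqrt \<mu> / \<alpha> * v) + v\<^sup>2 / 2"

lemma exit_energy_strict_mono:
  assumes "\<mu> > 0" "0 \<le> v" "v < w"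
  shows "exit_energy \<mu> v < exit_energy \<mu> w"
proof -
  have "F_ext (sqrt \<mu> / \<alpha> * v) < F_ext (sqrt \<mu> / \<alpha> * w)"
    unfolding F_ext_less_iff using assms alpha_pos by (intro mult_strict_left_mono) auto
  moreover have "v\<^sup>2 < w\<^sup>2" using assms by (intro power_strict_mono) auto
  ultimately show ?thesis by (simp add: exit_energy_def)
qed

lemma exit_energy_strict_mono_parameter:
  assumes "0 < \<mu>" "\<mu> < \<mu>'" "0 < v"
  shows "exit_energy \<mu> v < exit_energy \<mu>' v"
proof -
  have "sqrt \<mu> / \<alpha> * v < sqrt \<mu>' / \<alpha> * v"
    using assms alpha_pos by (intro mult_strict_right_mono divide_strict_right_mono) auto
  then show ?thesis by (simp add: exit_energy_def F_ext_less_iff)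
qed

lemma v1_unique:
  assumes mu: "\<mu> > 0" and v: "v > 0" "exit_energy \<mu> v = C"
  shows "v1 f \<alpha> C \<mu> = v"
  unfolding v1_def
proof (rule the_equality)
  have eq: "Fprim f (sqrt \<mu> / \<alpha> * w) + w\<^sup>2 / 2 = exit_energy \<mu> w" if "w > 0" for w
    using that mu alpha_pos by (simp add: exit_energy_def Fprim_eq)
  show "v > 0 \<and> Fprim f (sqrt \<mu> / \<alpha> * v) + v\<^sup>2 / 2 = C"
    using v eq by simp
  show "w = v" if "w > 0 \<and> Fprim f (sqrt \<mu> / \<alpha> * w) + w\<^sup>2 / 2 = C" for w
    using exit_energy_strict_mono[OF mu, of w v] exit_energy_strict_mono[OF mu, of v w] that v eq[of w]
    by (cases v w rule: linorder_cases) auto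
qed

lemma v1_root:
  assumes C: "C > 0" and mu: "\<mu> > 0"
  shows "v1 f \<alpha> C \<mu> > 0" "exit_energy \<mu> (v1 f \<alpha> C \<mu>) = C"
proof -
  have E0: "exit_energy \<mu> 0 = 0" by (simp add: exit_energy_def F_ext_0)
  have "F_ext (sqrt \<mu> / \<alpha> * sqrt (2 * C)) > F_ext 0"
    unfolding F_ext_less_iff using C mu alpha_pos by simp
  then have "exit_energy \<mu> (sqrt (2 * C)) \<ge> C"
    using C by (simp add: exit_energy_def F_ext_0)
  moreover have "continuous_on A (exit_energy \<mu>)" for A
    unfolding exit_energy_def[abs_def]
    by (intro continuous_on_add continuous_F_ext continuous_intros) auto
  ultimately obtain v where v: "0 \<le> v" "exit_energy \<mu> v = C"
    using IVT'[of "exit_energy \<mu>" 0 C "sqrt (2 * C)"] E0 C by auto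
  then have v0: "v > 0" using E0 C by (cases "v = 0") auto
  show "v1 f \<alpha> C \<mu> > 0" "exit_energy \<mu> (v1 f \<alpha> C \<mu>) = C"
    using v1_unique[OF mu v0 v(2)] v v0 by simp_all
qed

lemma v1_bound:
  assumes C: "C > 0" and mu: "\<mu> > 0"
  shows "v1 f \<alpha> C \<mu> < sqrt (2 * C)"
proof -
  let ?v = "v1 f \<alpha> C \<mu>"
  have "F_ext 0 < F_ext (sqrt \<mu> / \<alpha> * ?v)"
    unfolding F_ext_less_iff using v1_root[OF assms] mu alpha_pos by simp
  then have "?v\<^sup>2 < 2 * C"
    using v1_root(2)[OF assms] by (simp add: exit_energy_def F_ext_0)
  then show ?thesis by (rule real_less_rsqrt)
qed

lemma v1_strict_mono:
  assumes "0 < C" "C < C'" "0 < \<mu>"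
  shows "v1 f \<alpha> C \<mu> < v1 f \<alpha> C' \<mu>"
proof (rule ccontr)
  assume "\<not> ?thesis"
  then have "exit_energy \<mu> (v1 f \<alpha> C' \<mu>) \<le> exit_energy \<mu> (v1 f \<alpha> C \<mu>)"
    using exit_energy_strict_mono[OF \<open>0 < \<mu>\<close>, of "v1 f \<alpha> C' \<mu>" "v1 f \<alpha> C \<mu>"] v1_root[of C' \<mu>] assms
    by (cases "v1 f \<alpha> C' \<mu> = v1 f \<alpha> C \<mu>") auto
  then show False using v1_root assms by simp
qed

text \<open>A larger parameter makes the exit line steeper, so that the orbit meets it earlier.\<close>
lemma v1_strict_antimono:
  assumes C: "0 < C" and mu: "0 < \<mu>" "\<mu> < \<mu>'"
  shows "v1 f \<alpha> C \<mu>' < v1 f \<alpha> C \<mu>"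
proof (rule ccontr)
  let ?v = "v1 f \<alpha> C \<mu>" and ?v' = "v1 f \<alpha> C \<mu>'"
  assume "\<not> ?thesis"
  then have "exit_energy \<mu>' ?v \<le> exit_energy \<mu>' ?v'"
    using exit_energy_strict_mono[of \<mu>' ?v ?v'] v1_root[OF C mu(1)] mu by (cases "?v = ?v'") auto
  moreover have "exit_energy \<mu> ?v < exit_energy \<mu>' ?v"
    by (rule exit_energy_strict_mono_parameter[OF mu v1_root(1)[OF C mu(1)]])
  ultimately show False using v1_root(2)[OF C mu(1)] v1_root(2)[OF C, of \<mu>'] mu by simp
qed

lemma continuous_v1:
  assumes cont: "continuous_on A c" "continuous_on A m"
    and pos: "\<And>x. x \<in> A \<Longrightarrow> c x > 0" "\<And>x. x \<in> A \<Longrightarrow> m x > 0"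
  shows "continuous_on A (\<lambda>x. v1 f \<alpha> (c x) (m x))"
proof (rule continuous_on_positive_root[where Phi = "\<lambda>x v. exit_energy (m x) v - c x"])
  fix x assume x: "x \<in> A"
  note r = v1_root[OF pos(1)[OF x] pos(2)[OF x]]
  show "v1 f \<alpha> (c x) (m x) > 0" "exit_energy (m x) (v1 f \<alpha> (c x) (m x)) - c x = 0"
    using r by simp_all
  show "exit_energy (m x) y - c x < 0" if "0 < y" "y < v1 f \<alpha> (c x) (m x)" for y
    using exit_energy_strict_mono[OF pos(2)[OF x], of y "v1 f \<alpha> (c x) (m x)"] r that by simp
  show "exit_energy (m x) y - c x > 0" if "v1 f \<alpha> (c x) (m x) < y" for y
    using exit_energy_strict_mono[OF pos(2)[OF x], of "v1 f \<alpha> (c x) (m x)" y] r that by simp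
next
  show "continuous_on A (\<lambda>x. exit_energy (m x) y - c x)" for y
    unfolding exit_energy_def using alpha_pos
    by (intro continuous_on_diff continuous_on_add continuous_F_ext cont continuous_intros) auto
qed

section \<open>The length and the parameter as a function of the energy\<close>

text \<open>Up to the exit the orbit stays at positive heights, where extending \<open>f\<close> has changed
  nothing.\<close>
lemma len_eq:
  assumes C: "C > 0" and mu: "\<mu> > 0"
  shows "len f \<alpha> C \<mu> = 2 * travel_time C (v1 f \<alpha> C \<mu>) / sqrt \<mu>"
proof -
  let ?v = "v1 f \<alpha> C \<mu>"
  have "(LBINT v=0..?v. 1 / (sqrt \<mu> * f (Finv f (C - v\<^sup>2 / 2)))) = (LBINT v=0..?v. slowness C v / sqrt \<mu>)"
  proof (rule interval_integral_cong)
    fix w assume "w \<in> einterval (min 0 (ereal ?v)) (max 0 (ereal ?v))"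
    then have w: "0 < w" "w < ?v"
      using v1_root(1)[OF assms] by (auto simp: einterval_iff zero_ereal_def min_def max_def split: if_splits)
    have "w\<^sup>2 < (sqrt (2 * C))\<^sup>2"
      using w v1_bound[OF assms] by (intro power_strict_mono) auto
    then have "C - w\<^sup>2 / 2 > 0" using C by simp
    then show "1 / (sqrt \<mu> * f (Finv f (C - w\<^sup>2 / 2))) = slowness C w / sqrt \<mu>"
      using height_pos[of "C - w\<^sup>2 / 2"] by (simp add: slowness_def Finv_eq f_ext_eq mult.commute)
  qed
  then show ?thesis by (simp add: len_def travel_time_def)
qed

lemma len_strict_antimono:
  assumes C: "0 < C" and mu: "0 < \<mu>" "\<mu> < \<mu>'"
  shows "len f \<alpha> C \<mu>' < len f \<alpha> C \<mu>"
proof -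
  have mu': "0 < \<mu>'" using mu by simp
  have "travel_time C (v1 f \<alpha> C \<mu>') < travel_time C (v1 f \<alpha> C \<mu>)"
    unfolding travel_time_less_iff by (rule v1_strict_antimono[OF assms])
  moreover have "0 < travel_time C (v1 f \<alpha> C \<mu>')"
    by (rule travel_time_pos[OF v1_root(1)[OF C mu']])
  ultimately have "2 * travel_time C (v1 f \<alpha> C \<mu>') / sqrt \<mu>' < 2 * travel_time C (v1 f \<alpha> C \<mu>) / sqrt \<mu>"
    using mu by (intro frac_less) auto
  then show ?thesis by (simp add: len_eq C mu mu')
qed

lemma continuous_len:
  assumes cont: "continuous_on A c" "continuous_on A m"
    and pos: "\<And>x. x \<in> A \<Longrightarrow> c x > 0" "\<And>x. x \<in> A \<Longrightarrow> m x > 0"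
  shows "continuous_on A (\<lambda>x. len f \<alpha> (c x) (m x))"
proof -
  have "continuous_on A (\<lambda>x. 2 * travel_time (c x) (v1 f \<alpha> (c x) (m x)) / sqrt (m x))"
    using pos(2) by (intro continuous_intros continuous_travel_time continuous_v1 cont pos) force+
  then show ?thesis
    by (rule continuous_on_cong[THEN iffD1, rotated 2]) (simp_all add: len_eq pos)
qed

text \<open>The length is \<open>2 / sqrt \<mu>\<close> times the time to the exit. That time is at most
  \<open>sqrt (2 * C) / f 0\<close>, and for \<open>\<mu> \<le> 1\<close> it is at least its value at \<open>\<mu> = 1\<close>. The points \<open>a\<close> and
  \<open>b\<close> of the proof come from these two bounds.\<close>
lemma ex_len_eq_L0:
  assumes C: "C > 0" shows "\<exists>\<mu>>0. len f \<alpha> C \<mu> = L0"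
proof -
  define b where "b = (2 * sqrt (2 * C) / (f 0 * L0))\<^sup>2"
  define t where "t = travel_time C (v1 f \<alpha> C 1)"
  define a where "a = min (min 1 b) ((2 * t / L0)\<^sup>2)"
  have t: "t > 0" unfolding t_def using travel_time_pos v1_root[OF C] by simp
  have b: "b > 0" unfolding b_def using C f_pos[of 0] L0_pos by simp
  have a: "a > 0" "a \<le> 1" "a \<le> b" "a \<le> (2 * t / L0)\<^sup>2"
    unfolding a_def using b t L0_pos by auto
  have "travel_time C (v1 f \<alpha> C b) \<le> v1 f \<alpha> C b / f 0"
    using v1_root(1)[OF C b] by (intro travel_time_le) simp
  also have "\<dots> \<le> sqrt (2 * C) / f 0"
    using v1_bound[OF C b] f_pos[of 0] by (intro divide_right_mono) auto
  finally have "len f \<alpha> C b \<le> 2 * (sqrt (2 * C) / f 0) / sqrt b"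
    unfolding len_eq[OF C b] using b by (intro divide_right_mono) auto
  also have "sqrt b = 2 * sqrt (2 * C) / (f 0 * L0)"
    unfolding b_def using C f_pos[of 0] L0_pos by (simp add: less_imp_le)
  also have "2 * (sqrt (2 * C) / f 0) / (2 * sqrt (2 * C) / (f 0 * L0)) = L0"
    using C f_pos[of 0] L0_pos by (simp add: field_simps)
  finally have up: "len f \<alpha> C b \<le> L0" .
  have "v1 f \<alpha> C 1 \<le> v1 f \<alpha> C a"
    using v1_strict_antimono[OF C a(1), of 1] a(2) by (cases "a = 1") auto
  then have "t \<le> travel_time C (v1 f \<alpha> C a)"
    unfolding t_def using travel_time_less_iff[of C "v1 f \<alpha> C a" "v1 f \<alpha> C 1"] by linarith
  moreover have "sqrt a \<le> 2 * t / L0"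
    using a(4) t L0_pos by (intro real_le_lsqrt) auto
  ultimately have "L0 * sqrt a \<le> 2 * travel_time C (v1 f \<alpha> C a)"
    using L0_pos by (simp add: field_simps)
  then have lo: "L0 \<le> len f \<alpha> C a"
    unfolding len_eq[OF C a(1)] using a(1) by (simp add: field_simps)
  have "continuous_on {a..b} (len f \<alpha> C)"
    using continuous_len[of "{a..b}" "\<lambda>_. C" "\<lambda>\<mu>. \<mu>"] C a(1) by simp
  then obtain \<mu> where "a \<le> \<mu>" "len f \<alpha> C \<mu> = L0"
    using IVT2'[of "len f \<alpha> C" b L0 a] up lo a by auto
  then show ?thesis using a(1) by (intro exI[of _ \<mu>]) auto
qed

lemma lambda_of_unique:
  assumes C: "C > 0" and mu: "\<mu> > 0" "len f \<alpha> C \<mu> = L0"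
  shows "lambda_of f \<alpha> L0 C = \<mu>"
  unfolding lambda_of_def
proof (rule the_equality)
  show "\<nu> = \<mu>" if "\<nu> > 0 \<and> len f \<alpha> C \<nu> = L0" for \<nu>
    using len_strict_antimono[OF C, of \<nu> \<mu>] len_strict_antimono[OF C, of \<mu> \<nu>] that mu
    by (cases \<nu> \<mu> rule: linorder_cases) auto
qed (use mu in auto)

lemma lambda_of_root:
  assumes "C > 0"
  shows "lambda_of f \<alpha> L0 C > 0" "len f \<alpha> C (lambda_of f \<alpha> L0 C) = L0"
  using ex_len_eq_L0[OF assms] lambda_of_unique[OF assms] by auto

lemma continuous_lambda_of: "continuous_on {0<..} (lambda_of f \<alpha> L0)"
proof (rule continuous_on_positive_root[where Phi = "\<lambda>C \<mu>. L0 - len f \<alpha> C \<mu>"])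
  fix C :: real assume "C \<in> {0<..}"
  then have C: "C > 0" by simp
  note r = lambda_of_root[OF C]
  show "lambda_of f \<alpha> L0 C > 0" "L0 - len f \<alpha> C (lambda_of f \<alpha> L0 C) = 0"
    using r by simp_all
  show "L0 - len f \<alpha> C \<mu> < 0" if "0 < \<mu>" "\<mu> < lambda_of f \<alpha> L0 C" for \<mu>
    using len_strict_antimono[OF C that] r by simp
  show "L0 - len f \<alpha> C \<mu> > 0" if "lambda_of f \<alpha> L0 C < \<mu>" for \<mu>
    using len_strict_antimono[OF C r(1) that] r by simp
next
  show "continuous_on {0<..} (\<lambda>C. L0 - len f \<alpha> C \<mu>)" if "0 < \<mu>" for \<mu>
    using that by (intro continuous_intros continuous_len) auto
qed

section \<open>Orbits\<close>

definition velocity :: "real \<Rightarrow> real \<Rightarrow> real" where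
  "velocity C = inv (travel_time C)"

definition position :: "real \<Rightarrow> real \<Rightarrow> real" where
  "position C s = height (C - (velocity C s)\<^sup>2 / 2)"

lemma velocity_travel_time: "velocity C (travel_time C v) = v"
  unfolding velocity_def using travel_time_bijection(2) by (simp add: bij_is_inj)

lemma travel_time_velocity: "travel_time C (velocity C s) = s"
  unfolding velocity_def using travel_time_bijection(2) by (simp add: bij_is_surj surj_f_inv_f)

lemma velocity_less_iff: "velocity C s < velocity C t \<longleftrightarrow> s < t"
  using travel_time_less_iff[of C "velocity C s" "velocity C t"] by (simp add: travel_time_velocity)

lemma velocity_0: "velocity C 0 = 0"
  using velocity_travel_time[of C 0] by (simp add: travel_time_0)

lemma velocity_minus: "velocity C (- s) = - velocity C s"
  using velocity_travel_time[of C "- velocity C s"]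
  by (simp add: travel_time_minus travel_time_velocity)

lemma position_minus: "position C (- s) = position C s"
  by (simp add: position_def velocity_minus)

lemma position_0: "position C 0 = height C"
  by (simp add: position_def velocity_0)

lemma orbit_energy: "F_ext (position C s) = C - (velocity C s)\<^sup>2 / 2"
  by (simp add: position_def F_height)

lemma velocity_deriv: "(velocity C has_real_derivative f_ext (position C s)) (at s)"
  using travel_time_bijection(3)[of C s]
  by (simp add: velocity_def[symmetric] slowness_def position_def)

lemma position_deriv: "(position C has_real_derivative - velocity C s) (at s)"
proof -
  have "((\<lambda>s. C - (velocity C s)\<^sup>2 / 2) has_real_derivative
      - (velocity C s * f_ext (position C s))) (at s)"
    by (auto intro!: derivative_eq_intros velocity_deriv)
  from DERIV_chain2[OF height_deriv this] show ?thesis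
    unfolding position_def[abs_def] using f_ext_pos[of "position C s"]
    by (simp add: position_def less_imp_neq[symmetric])
qed

lemma continuous_position: "continuous_on A (position C)"
  using position_deriv by (meson DERIV_isCont continuous_at_imp_continuous_on)

text \<open>The dictionary between lengths and solutions: \<open>len f \<alpha> C \<mu> = L0\<close> turns into the boundary
  condition at time \<open>S\<close>. Positivity holds because the velocity at time \<open>S\<close> is the largest one and
  the height there is still positive.\<close>
lemma orbit_exit:
  assumes C: "C > 0" and mu: "\<mu> > 0" and len: "len f \<alpha> C \<mu> = L0"
  defines "S \<equiv> sqrt \<mu> * L0 / 2"
  shows "velocity C S = v1 f \<alpha> C \<mu>" "position C S = sqrt \<mu> / \<alpha> * v1 f \<alpha> C \<mu>"
    and "\<bar>s\<bar> \<le> S \<Longrightarrow> position C s > 0"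
proof -
  have "travel_time C (v1 f \<alpha> C \<mu>) = S"
    using len mu unfolding len_eq[OF C mu] S_def by (simp add: field_simps)
  then show v: "velocity C S = v1 f \<alpha> C \<mu>"
    using velocity_travel_time[of C "v1 f \<alpha> C \<mu>"] by simp
  have exit: "C - (v1 f \<alpha> C \<mu>)\<^sup>2 / 2 = F_ext (sqrt \<mu> / \<alpha> * v1 f \<alpha> C \<mu>)"
    using v1_root(2)[OF C mu] by (simp add: exit_energy_def)
  show "position C S = sqrt \<mu> / \<alpha> * v1 f \<alpha> C \<mu>"
    unfolding position_def v exit by (rule height_F)
  assume s: "\<bar>s\<bar> \<le> S"
  have "velocity C s \<le> v1 f \<alpha> C \<mu>" "- v1 f \<alpha> C \<mu> \<le> velocity C s"
    using s velocity_less_iff[of C S s] velocity_less_iff[of C s "- S"]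
    by (auto simp: v velocity_minus not_less)
  then have "(velocity C s)\<^sup>2 \<le> (v1 f \<alpha> C \<mu>)\<^sup>2"
    by (intro abs_le_square_iff[THEN iffD1]) auto
  moreover have "F_ext 0 < F_ext (sqrt \<mu> / \<alpha> * v1 f \<alpha> C \<mu>)"
    unfolding F_ext_less_iff using mu alpha_pos v1_root(1)[OF C mu] by simp
  ultimately have "F_ext 0 < F_ext (position C s)"
    using exit by (simp add: orbit_energy)
  then show "position C s > 0" by (simp add: F_ext_less_iff)
qed

text \<open>At an interior minimum of the difference the velocities agree, so the orbit of larger energy is
  higher there. At the two ends it is higher since the heights there are increasing functions of the
  energy.\<close>
lemma orbits_ordered:
  assumes C: "0 < C" "C < C'" and mu: "\<mu> > 0"
    and len: "len f \<alpha> C \<mu> = L0" "len f \<alpha> C' \<mu> = L0"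
    and s: "0 \<le> s" "s \<le> sqrt \<mu> * L0 / 2"
  shows "position C s < position C' s"
proof -
  define S where "S = sqrt \<mu> * L0 / 2"
  define d where "d = (\<lambda>s. position C' s - position C s)"
  have C': "C' > 0" using C by simp
  have "d 0 > 0"
    using C by (simp add: d_def position_0 height_less_iff)
  have "d S = sqrt \<mu> / \<alpha> * (v1 f \<alpha> C' \<mu> - v1 f \<alpha> C \<mu>)"
    unfolding d_def S_def orbit_exit(2)[OF C(1) mu len(1)] orbit_exit(2)[OF C' mu len(2)]
    by (simp add: right_diff_distrib)
  then have "d S > 0"
    using v1_strict_mono[OF C mu] mu alpha_pos by simp
  have "continuous_on {0..S} d"
    unfolding d_def by (intro continuous_on_diff continuous_position)
  moreover have "{0..S} \<noteq> {}" using s by (simp add: S_def)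
  ultimately obtain m where m: "m \<in> {0..S}" "\<And>t. t \<in> {0..S} \<Longrightarrow> d m \<le> d t"
    using continuous_attains_inf[of "{0..S}" d] by auto
  have "d m > 0"
  proof (rule ccontr)
    assume neg: "\<not> d m > 0"
    then have m0: "0 < m" "m < S"
      using m(1) \<open>d 0 > 0\<close> \<open>d S > 0\<close> by (auto simp: less_le)
    have "(d has_real_derivative velocity C m - velocity C' m) (at m)"
      unfolding d_def by (auto intro!: derivative_eq_intros position_deriv)
    then have "velocity C m - velocity C' m = 0"
    proof (rule DERIV_local_min)
      show "0 < min m (S - m)" using m0 by simp
      show "\<forall>t. \<bar>m - t\<bar> < min m (S - m) \<longrightarrow> d m \<le> d t"
      proof (intro allI impI m(2))
        fix t assume "\<bar>m - t\<bar> < min m (S - m)"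
        then show "t \<in> {0..S}" by (simp add: abs_less_iff)
      qed
    qed
    then have "F_ext (position C m) < F_ext (position C' m)"
      using C by (simp add: orbit_energy)
    then show False using neg by (simp add: F_ext_less_iff d_def)
  qed
  then show ?thesis using m(2)[of s] s by (simp add: S_def d_def)
qed

text \<open>Let \<open>W\<close> be the Wronskian of \<open>p2 - p1\<close> and \<open>p3 - p2\<close>. It vanishes at \<open>0\<close>, where all velocities
  are \<open>0\<close>, and at \<open>S\<close>, where the exit condition makes heights proportional to velocities. Its
  derivative compares the secant slopes of \<open>f\<close> on \<open>[p1, p2]\<close> and \<open>[p2, p3]\<close>, and strict
  convexity makes it negative.\<close>
lemma no_three_orbits:
  assumes C: "0 < C1" "C1 < C2" "C2 < C3" and mu: "\<mu> > 0"
    and len: "len f \<alpha> C1 \<mu> = L0" "len f \<alpha> C2 \<mu> = L0" "len f \<alpha> C3 \<mu> = L0"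
  shows False
proof -
  define S where "S = sqrt \<mu> * L0 / 2"
  have S: "S > 0" using mu L0_pos by (simp add: S_def)
  have C23: "C2 > 0" "C3 > 0" using C by simp_all
  note exit1 = orbit_exit[OF C(1) mu len(1), folded S_def]
  note exit2 = orbit_exit[OF C23(1) mu len(2), folded S_def]
  note exit3 = orbit_exit[OF C23(2) mu len(3), folded S_def]
  define W where "W = (\<lambda>s. (position C2 s - position C1 s) * (velocity C2 s - velocity C3 s)
      - (position C3 s - position C2 s) * (velocity C1 s - velocity C2 s))"
  have "W S < W 0"
  proof (rule DERIV_neg_imp_decreasing[OF S])
    fix s assume s: "0 \<le> s" "s \<le> S"
    let ?p1 = "position C1 s" and ?p2 = "position C2 s" and ?p3 = "position C3 s"
    have p: "0 < ?p1" "?p1 < ?p2" "?p2 < ?p3"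
      using exit1(3)[of s] s orbits_ordered[OF C(1,2) mu len(1,2), of s]
        orbits_ordered[OF C23(1) C(3) mu len(2,3), of s] by (simp_all add: S_def)
    have W': "(W has_real_derivative
        (?p3 - ?p2) * (f ?p2 - f ?p1) - (?p2 - ?p1) * (f ?p3 - f ?p2)) (at s)"
      unfolding W_def using p
      by (auto intro!: derivative_eq_intros position_deriv velocity_deriv
          simp: f_ext_eq algebra_simps)
    obtain x where x: "?p1 < x" "x < ?p2" "f ?p2 - f ?p1 = (?p2 - ?p1) * f' x"
      using MVT2[of ?p1 ?p2 f f'] p f_deriv by blast
    obtain y where y: "?p2 < y" "y < ?p3" "f ?p3 - f ?p2 = (?p3 - ?p2) * f' y"
      using MVT2[of ?p2 ?p3 f f'] p f_deriv by blast
    have "(?p3 - ?p2) * (f ?p2 - f ?p1) - (?p2 - ?p1) * (f ?p3 - f ?p2)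
        = (?p3 - ?p2) * (?p2 - ?p1) * (f' x - f' y)"
      unfolding x(3) y(3) by (simp add: algebra_simps)
    also have "\<dots> < 0"
      using p x y f'_strict_mono[of x y] by (intro mult_pos_neg) auto
    finally show "\<exists>d. (W has_real_derivative d) (at s) \<and> d < 0"
      using W' by blast
  qed
  moreover have "W 0 = 0" by (simp add: W_def velocity_0)
  moreover have "W S = 0"
    unfolding W_def exit1(1,2) exit2(1,2) exit3(1,2) by (simp add: algebra_simps)
  ultimately show False by simp
qed

section \<open>Behaviour for small and large energies\<close>

text \<open>Since the velocity increases, at most half of the height \<open>M\<close> is lost up to time \<open>S / 2\<close>. Until
  then the acceleration is at least \<open>f (M / 2)\<close>, so that the velocity afterwards exceeds
  \<open>S / 2 * f (M / 2)\<close>. As the height stays positive up to time \<open>S\<close>, this forces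
  \<open>S / 2 * (S / 2 * f (M / 2)) < M\<close>.\<close>
lemma parameter_bound:
  assumes C: "C > 0" and mu: "\<mu> > 0" and len: "len f \<alpha> C \<mu> = L0"
  shows "\<mu> < 16 / L0\<^sup>2 * (height C / f (height C / 2))"
proof -
  define S where "S = sqrt \<mu> * L0 / 2"
  define M where "M = height C"
  let ?p = "position C" and ?v = "velocity C"
  have S: "S > 0" using mu L0_pos by (simp add: S_def)
  have M: "M > 0" unfolding M_def by (rule height_pos[OF C])
  have end_pos: "?p S > 0" using orbit_exit(3)[OF C mu len, of S] S by (simp add: S_def)
  obtain a where a: "0 < a" "a < S / 2" "?p (S / 2) - ?p 0 = (S / 2 - 0) * - ?v a"
    using MVT2[of 0 "S / 2" ?p "\<lambda>s. - ?v s"] S position_deriv by auto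
  obtain b where b: "S / 2 < b" "b < S" "?p S - ?p (S / 2) = (S - S / 2) * - ?v b"
    using MVT2[of "S / 2" S ?p "\<lambda>s. - ?v s"] S position_deriv by auto
  obtain z where z: "0 < z" "z < S / 2" "?v (S / 2) - ?v 0 = (S / 2 - 0) * f_ext (?p z)"
    using MVT2[of 0 "S / 2" ?v "\<lambda>s. f_ext (?p s)"] S velocity_deriv by auto
  have v: "0 < ?v a" "?v a < ?v b" "0 < ?v z" "?v z < ?v (S / 2)" "?v (S / 2) < ?v b"
    using a b z S velocity_less_iff[of C 0] by (simp_all add: velocity_0 velocity_less_iff)
  have first: "?p (S / 2) = M - S / 2 * ?v a" using a(3) by (simp add: position_0 M_def)
  have second: "?p S = ?p (S / 2) - S / 2 * ?v b" using b(3) by simp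
  have "S / 2 * ?v a \<le> S / 2 * ?v b" "0 < S / 2 * ?v a"
    using S v by (auto intro!: mult_left_mono)
  then have half: "M / 2 \<le> ?p (S / 2)" "?p (S / 2) \<le> M"
    using first second end_pos by linarith+
  have "(?v z)\<^sup>2 < (?v (S / 2))\<^sup>2" using v by (intro power_strict_mono) auto
  then have "F_ext (?p (S / 2)) < F_ext (?p z)" by (simp add: orbit_energy)
  then have "M / 2 \<le> ?p z" using half by (simp add: F_ext_less_iff)
  then have "f (M / 2) \<le> f_ext (?p z)" using f_ext_mono[of "M / 2"] M by (simp add: f_ext_eq)
  then have "S / 2 * f (M / 2) \<le> ?v (S / 2)"
    using z(3) S by (simp add: velocity_0 mult_left_mono)
  then have "S / 2 * (S / 2 * f (M / 2)) \<le> S / 2 * ?v b"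
    using S v by (intro mult_left_mono) auto
  also have "\<dots> < M" using second end_pos half by linarith
  finally have "S\<^sup>2 * f (M / 2) < 4 * M" by (simp add: power2_eq_square)
  also have "S\<^sup>2 = \<mu> * L0\<^sup>2 / 4" using mu by (simp add: S_def power_mult_distrib power_divide)
  finally show ?thesis
    using f_pos[of "M / 2"] L0_pos unfolding M_def[symmetric] by (simp add: field_simps)
qed

lemma lambda_of_tendsto_0:
  assumes lim: "((\<lambda>C. height C / f (height C / 2)) \<longlongrightarrow> 0) F"
    and pos: "\<forall>\<^sub>F C in F. C > 0"
  shows "(lambda_of f \<alpha> L0 \<longlongrightarrow> 0) F"
proof (rule tendsto_sandwich)
  show "\<forall>\<^sub>F C in F. 0 \<le> lambda_of f \<alpha> L0 C"
    using pos by eventually_elim (use lambda_of_root in force)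
  show "\<forall>\<^sub>F C in F. lambda_of f \<alpha> L0 C \<le> 16 / L0\<^sup>2 * (height C / f (height C / 2))"
    using pos by eventually_elim (intro less_imp_le parameter_bound lambda_of_root)
  show "((\<lambda>C. 16 / L0\<^sup>2 * (height C / f (height C / 2))) \<longlongrightarrow> 0) F"
    using tendsto_mult_left[OF lim, of "16 / L0\<^sup>2"] by simp
qed simp

lemma lambda_of_at_0: "(lambda_of f \<alpha> L0 \<longlongrightarrow> 0) (at_right 0)"
proof (rule lambda_of_tendsto_0)
  have "isCont height 0" using height_deriv DERIV_isCont by blast
  then have h: "(height \<longlongrightarrow> 0) (at_right 0)"
    using height_0 by (metis isCont_def filterlim_at_split)
  have "isCont f 0" using f_deriv DERIV_isCont by blast
  moreover have "((\<lambda>C. height C / 2) \<longlongrightarrow> 0) (at_right 0)"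
    using tendsto_divide[OF h tendsto_const, of 2] by simp
  ultimately have "((\<lambda>C. f (height C / 2)) \<longlongrightarrow> f 0) (at_right 0)"
    by (rule isCont_tendsto_compose)
  from tendsto_divide[OF h this] show "((\<lambda>C. height C / f (height C / 2)) \<longlongrightarrow> 0) (at_right 0)"
    using f_pos[of 0] by simp
  show "\<forall>\<^sub>F C in at_right (0::real). C > 0" by (rule eventually_at_right_less)
qed

text \<open>The maximal height tends to infinity with the energy, and there superlinearity of \<open>f\<close> takes
  over.\<close>
lemma lambda_of_at_top: "(lambda_of f \<alpha> L0 \<longlongrightarrow> 0) at_top"
proof (rule lambda_of_tendsto_0)
  have h: "filterlim (\<lambda>C. 1 / 2 * height C) at_top at_top"
  proof (rule filterlim_tendsto_pos_mult_at_top[OF tendsto_const])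
    show "filterlim height at_top at_top"
      unfolding filterlim_at_top_dense
    proof
      fix K
      show "\<forall>\<^sub>F C in at_top. K < height C"
        using eventually_gt_at_top[of "F_ext K"]
        by eventually_elim (metis height_F height_less_iff)
    qed
  qed simp
  have "((\<lambda>C. 2 * inverse (f (1 / 2 * height C) / (1 / 2 * height C))) \<longlongrightarrow> 2 * 0) at_top"
    by (intro tendsto_mult tendsto_const tendsto_inverse_0_at_top filterlim_compose[OF superlinear h])
  then show "((\<lambda>C. height C / f (height C / 2)) \<longlongrightarrow> 0) at_top"
    by simp
  show "\<forall>\<^sub>F C in at_top. C > (0::real)" by (rule eventually_gt_at_top)
qed

section \<open>Solvable parameters\<close>

lemma bvp_solution_of_orbit:
  assumes C: "C > 0" and mu: "\<mu> > 0" and len: "len f \<alpha> C \<mu> = L0"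
  shows "bvp_solution f \<alpha> L0 \<mu> (\<lambda>x. position C (sqrt \<mu> * (x - L0 / 2)))"
proof -
  define S where "S = sqrt \<mu> * L0 / 2"
  note exit = orbit_exit[OF C mu len, folded S_def]
  define r where "r = (\<lambda>x. sqrt \<mu> * (x - L0 / 2))"
  have r': "(r has_real_derivative sqrt \<mu>) (at x)" for x
    unfolding r_def by (auto intro!: derivative_eq_intros)
  have sq: "sqrt \<mu> * (sqrt \<mu> * t) = \<mu> * t" for t
    using mu by (simp add: mult.assoc[symmetric])
  have ends: "r 0 = - S" "r L0 = S"
    by (simp_all add: r_def S_def)
  have u1: "((\<lambda>x. position C (r x)) has_real_derivative - sqrt \<mu> * velocity C (r x)) (at x)" for x
    using DERIV_chain2[OF position_deriv r', of C x] by (simp add: mult.commute)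
  have u2: "((\<lambda>x. - sqrt \<mu> * velocity C (r x)) has_real_derivative - \<mu> * f_ext (position C (r x))) (at x)" for x
    using DERIV_cmult[OF DERIV_chain2[OF velocity_deriv r'], of "- sqrt \<mu>" C x]
    by (simp add: mult.commute mult.left_commute sq)
  have "bvp_solution f \<alpha> L0 \<mu> (\<lambda>x. position C (r x))"
    unfolding bvp_solution_def
  proof (intro exI[of _ "\<lambda>x. - sqrt \<mu> * velocity C (r x)"] conjI ballI)
    show "((\<lambda>x. position C (r x)) has_real_derivative - sqrt \<mu> * velocity C (r x)) (at x within {0..L0})" for x
      using u1 by (rule has_field_derivative_at_within)
    show "continuous_on {0..L0} (\<lambda>x. - sqrt \<mu> * velocity C (r x))"
      using u2 by (meson DERIV_isCont continuous_at_imp_continuous_on)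
    show "\<exists>u''. ((\<lambda>x. - sqrt \<mu> * velocity C (r x)) has_real_derivative u'') (at x) \<and>
        u'' + \<mu> * f (position C (r x)) = 0" if x: "x \<in> {0<..<L0}" for x
    proof -
      have "\<bar>x - L0 / 2\<bar> \<le> L0 / 2" using x by (intro abs_leI) auto
      then have "\<bar>r x\<bar> \<le> S"
        using mu by (simp add: r_def S_def abs_mult mult_left_mono)
      then show ?thesis using u2[of x] exit(3)[of "r x"] by (auto simp: f_ext_eq)
    qed
    show "- sqrt \<mu> * velocity C (r 0) = \<alpha> * position C (r 0)"
      using alpha_pos by (simp add: ends velocity_minus position_minus exit(1,2))
    show "- sqrt \<mu> * velocity C (r L0) = - \<alpha> * position C (r L0)"
      using alpha_pos by (simp add: ends exit(1,2))
  qed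
  then show ?thesis by (simp add: r_def)
qed

text \<open>A solution is strictly concave, and the boundary conditions then make it positive at the ends and
  nonnegative in between. So it conserves the energy formed with the extended primitive, its rescaled
  slope runs from \<open>v1\<close> to \<open>- v1\<close>, and along it \<open>travel_time\<close> decreases at the rate \<open>sqrt \<mu>\<close>.
  Integration over \<open>[0, L0]\<close> gives the length equation.\<close>
lemma orbit_of_bvp_solution:
  assumes mu: "\<mu> > 0" and sol: "bvp_solution f \<alpha> L0 \<mu> u"
  obtains C where "C > 0" "len f \<alpha> C \<mu> = L0"
proof -
  obtain u' where u1: "\<And>x. x \<in> {0..L0} \<Longrightarrow> (u has_real_derivative u' x) (at x within {0..L0})"
    and cont_u': "continuous_on {0..L0} u'"
    and u2: "\<And>x. x \<in> {0<..<L0} \<Longrightarrow> \<exists>u''. (u' has_real_derivative u'') (at x) \<and> u'' + \<mu> * f (u x) = 0"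
    and bc0: "u' 0 = \<alpha> * u 0" and bc1: "u' L0 = - \<alpha> * u L0"
    using sol unfolding bvp_solution_def by blast
  have u': "(u has_real_derivative u' x) (at x)" if "0 < x" "x < L0" for x
  proof -
    have "at x within {0..L0} = at x" using that by (intro at_within_interior) auto
    then show ?thesis using u1[of x] that by simp
  qed
  have u'': "(u' has_real_derivative - \<mu> * f (u x)) (at x)" if x: "0 < x" "x < L0" for x
  proof -
    obtain d where d: "(u' has_real_derivative d) (at x)" "d + \<mu> * f (u x) = 0"
      using u2[of x] x by auto
    then have "d = - \<mu> * f (u x)" by simp
    then show ?thesis using d(1) by simp
  qed
  have cont_u: "continuous_on {0..L0} u"
    using u1 by (meson DERIV_continuous_on)
  have u'_decr: "u' y < u' x" if "0 \<le> x" "x < y" "y \<le> L0" for x y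
  proof (rule DERIV_neg_imp_decreasing_open[OF that(2)])
    show "continuous_on {x..y} u'"
      by (rule continuous_on_subset[OF cont_u']) (use that in auto)
    show "\<exists>d. (u' has_real_derivative d) (at z) \<and> d < 0" if z: "x < z" "z < y" for z
      using u''[of z] z \<open>0 \<le> x\<close> \<open>y \<le> L0\<close> mu f_pos[of "u z"]
      by (intro exI[of _ "- \<mu> * f (u z)"]) auto
  qed
  have mvt: "\<exists>z. x < z \<and> z < y \<and> u y - u x = (y - x) * u' z" if xy: "0 \<le> x" "x < y" "y \<le> L0" for x y
  proof -
    have "continuous_on {x..y} u"
      by (rule continuous_on_subset[OF cont_u]) (use xy in auto)
    then obtain l z where lz: "x < z" "z < y" "(u has_real_derivative l) (at z)" "u y - u x = (y - x) * l"
      using MVT[OF xy(2), of u] u' xy by (auto simp: real_differentiable_def) (metis le_less_trans less_le_trans)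
    then have "l = u' z"
      using u'[of z] xy by (auto intro: DERIV_unique)
    then show ?thesis using lz by blast
  qed
  \<comment> \<open>The mean slope lies strictly between the two end slopes; this excludes nonpositive end values.\<close>
  obtain z where z: "0 < z" "z < L0" "u L0 - u 0 = (L0 - 0) * u' z"
    using mvt[of 0 L0] L0_pos by auto
  have slopes: "u' L0 < u' z" "u' z < u' 0"
    using u'_decr[of z L0] u'_decr[of 0 z] z by auto
  have u0: "u 0 > 0"
  proof (rule ccontr)
    assume "\<not> u 0 > 0"
    then have "u' 0 \<le> 0" using bc0 alpha_pos by (simp add: mult_nonneg_nonpos)
    then have "(L0 - 0) * u' z < 0" using slopes L0_pos by (intro mult_pos_neg) auto
    then have "u L0 < 0" using z(3) \<open>\<not> u 0 > 0\<close> by linarith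
    then have "u' L0 > 0" using bc1 alpha_pos by (simp add: mult_pos_neg)
    then show False using slopes \<open>u' 0 \<le> 0\<close> by simp
  qed
  have uL: "u L0 > 0"
  proof (rule ccontr)
    assume "\<not> u L0 > 0"
    then have "u' L0 \<ge> 0" using bc1 alpha_pos by (simp add: mult_nonneg_nonpos)
    then have "(L0 - 0) * u' z > 0" using slopes L0_pos by (intro mult_pos_pos) auto
    then show False using z(3) \<open>\<not> u L0 > 0\<close> u0 by linarith
  qed
  have u_nonneg: "u x \<ge> 0" if x: "0 < x" "x < L0" for x
  proof (rule ccontr)
    assume neg: "\<not> u x \<ge> 0"
    obtain y where y: "0 < y" "y < x" "u x - u 0 = (x - 0) * u' y"
      using mvt[of 0 x] x by auto
    obtain w where w: "x < w" "w < L0" "u L0 - u x = (L0 - x) * u' w"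
      using mvt[of x L0] x by auto
    have "x * u' y < 0" "(L0 - x) * u' w > 0" using y w neg u0 uL by auto
    then have "u' y < 0" "u' w > 0" using x by (simp_all add: mult_less_0_iff zero_less_mult_iff)
    then show False using u'_decr[of y w] y w x by simp
  qed
  \<comment> \<open>The sign is opposite to that of the velocity of an orbit, so \<open>v\<close> decreases.\<close>
  define v where "v = (\<lambda>x. u' x / sqrt \<mu>)"
  have sq: "sqrt \<mu> > 0" "sqrt \<mu> * sqrt \<mu> = \<mu>" using mu by simp_all
  have cont_v: "continuous_on {0..L0} v"
    unfolding v_def using sq by (intro continuous_intros cont_u') auto
  have v': "(v has_real_derivative - (sqrt \<mu> * f (u x))) (at x)" if x: "0 < x" "x < L0" for x
  proof -
    have "- \<mu> * f (u x) / sqrt \<mu> = - (sqrt \<mu> * f (u x))"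
      using sq by (simp add: field_simps)
    then show ?thesis
      unfolding v_def using DERIV_cdivide[OF u''[OF x], of "sqrt \<mu>"] by simp
  qed
  define C where "C = F_ext (u 0) + (v 0)\<^sup>2 / 2"
  have energy: "F_ext (u x) + (v x)\<^sup>2 / 2 = C" if "0 \<le> x" "x \<le> L0" for x
    unfolding C_def
  proof (rule DERIV_isconst2[OF L0_pos _ _ that])
    show "continuous_on {0..L0} (\<lambda>x. F_ext (u x) + (v x)\<^sup>2 / 2)"
      by (intro continuous_on_add continuous_F_ext cont_u continuous_intros cont_v) auto
    fix x assume x: "0 < x" "x < L0"
    have "((\<lambda>x. F_ext (u x) + (v x)\<^sup>2 / 2) has_real_derivative
        f_ext (u x) * u' x + v x * - (sqrt \<mu> * f (u x))) (at x)"
      by (auto intro!: derivative_eq_intros DERIV_chain2[OF F_ext_deriv] u' v' x)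
    moreover have "f_ext (u x) * u' x + v x * - (sqrt \<mu> * f (u x)) = 0"
      using u_nonneg[OF x] sq by (simp add: f_ext_eq v_def)
    ultimately show "((\<lambda>x. F_ext (u x) + (v x)\<^sup>2 / 2) has_real_derivative 0) (at x)" by simp
  qed
  have v_ends: "v 0 > 0" "v L0 < 0" "u 0 = sqrt \<mu> / \<alpha> * v 0" "u L0 = sqrt \<mu> / \<alpha> * - v L0"
    using sq alpha_pos u0 uL by (simp_all add: v_def bc0 bc1 divide_less_0_iff)
  have E: "exit_energy \<mu> (v 0) = C" "exit_energy \<mu> (- v L0) = C"
    unfolding exit_energy_def v_ends(3,4)[symmetric] using energy[of 0] energy[of L0] L0_pos by simp_all
  have vs: "v1 f \<alpha> C \<mu> = v 0" "v1 f \<alpha> C \<mu> = - v L0"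
    using v1_unique[OF mu _ E(1)] v1_unique[OF mu _ E(2)] v_ends by simp_all
  have "F_ext (u 0) > F_ext 0" unfolding F_ext_less_iff by (rule u0)
  then have C: "C > 0" unfolding C_def F_ext_0 by (simp add: add_pos_nonneg)
  have "travel_time C (v L0) + sqrt \<mu> * L0 = travel_time C (v 0) + sqrt \<mu> * 0"
  proof (rule DERIV_isconst_end[OF L0_pos])
    show "continuous_on {0..L0} (\<lambda>x. travel_time C (v x) + sqrt \<mu> * x)"
      by (intro continuous_on_add continuous_travel_time cont_v continuous_intros)
    fix x assume x: "0 < x" "x < L0"
    have "C - (v x)\<^sup>2 / 2 = F_ext (u x)" using energy[of x] x by simp
    then have "slowness C (v x) = 1 / f (u x)"
      using u_nonneg[OF x] by (simp add: slowness_def height_F f_ext_eq)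
    moreover have "((\<lambda>x. travel_time C (v x) + sqrt \<mu> * x) has_real_derivative
        slowness C (v x) * - (sqrt \<mu> * f (u x)) + sqrt \<mu>) (at x)"
      by (auto intro!: derivative_eq_intros DERIV_chain2[OF travel_time_deriv] v' x)
    ultimately show "((\<lambda>x. travel_time C (v x) + sqrt \<mu> * x) has_real_derivative 0) (at x)"
      using f_pos[of "u x"] by (simp add: less_imp_neq[symmetric])
  qed
  moreover have "travel_time C (v L0) = - travel_time C (v 0)"
  proof -
    have "v L0 = - v 0" using vs by simp
    then show ?thesis by (simp add: travel_time_minus)
  qed
  ultimately have "2 * travel_time C (v 0) = sqrt \<mu> * L0" by simp
  then have "len f \<alpha> C \<mu> = L0"
    unfolding len_eq[OF C mu] vs(1) using sq by simp
  with C that show thesis by blast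
qed

lemma bvp_solvable_iff:
  assumes mu: "\<mu> > 0"
  shows "(\<exists>u. bvp_solution f \<alpha> L0 \<mu> u) \<longleftrightarrow> \<mu> \<in> lambda_of f \<alpha> L0 ` {0<..}"
proof
  assume "\<exists>u. bvp_solution f \<alpha> L0 \<mu> u"
  then obtain C where "C > 0" "len f \<alpha> C \<mu> = L0" using orbit_of_bvp_solution[OF mu] by blast
  then show "\<mu> \<in> lambda_of f \<alpha> L0 ` {0<..}"
    using lambda_of_unique[OF _ mu] by force
next
  assume "\<mu> \<in> lambda_of f \<alpha> L0 ` {0<..}"
  then obtain C where "C > 0" "\<mu> = lambda_of f \<alpha> L0 C" by auto
  then show "\<exists>u. bvp_solution f \<alpha> L0 \<mu> u"
    using bvp_solution_of_orbit[OF _ mu] lambda_of_root by blast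
qed

lemma lambda_star_eq:
  assumes range: "lambda_of f \<alpha> L0 ` {0<..} = {0<..\<nu>}" and nu: "\<nu> > 0"
  shows "lambda_star f \<alpha> L0 = \<nu>"
  unfolding lambda_star_def
proof (rule the_equality)
  have solvable: "(\<exists>u. bvp_solution f \<alpha> L0 \<mu> u) \<longleftrightarrow> \<mu> \<le> \<nu>" if "\<mu> > 0" for \<mu>
    using bvp_solvable_iff[OF that] that by (simp add: range)
  then show "is_critical f \<alpha> L0 \<nu>"
    unfolding is_critical_def using nu by force
  show "\<nu>' = \<nu>" if crit: "is_critical f \<alpha> L0 \<nu>'" for \<nu>'
  proof (rule antisym)
    show "\<nu>' \<le> \<nu>" using crit solvable[of \<nu>'] unfolding is_critical_def by blast
    show "\<nu> \<le> \<nu>'" using crit solvable[of \<nu>] nu unfolding is_critical_def by (meson not_le order_refl)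
  qed
qed

lemma lambda_of_no_level_thrice:
  assumes "0 < a" "a < b" "b < c"
    and eq: "lambda_of f \<alpha> L0 a = lambda_of f \<alpha> L0 b" "lambda_of f \<alpha> L0 b = lambda_of f \<alpha> L0 c"
  shows False
proof (rule no_three_orbits[OF assms(1-3)])
  have "0 < b" "0 < c" using assms by simp_all
  note roots = lambda_of_root[OF assms(1)] lambda_of_root[OF this(1)] lambda_of_root[OF this(2)]
  show "lambda_of f \<alpha> L0 b > 0" by (rule roots)
  show "len f \<alpha> a (lambda_of f \<alpha> L0 b) = L0" "len f \<alpha> b (lambda_of f \<alpha> L0 b) = L0"
    "len f \<alpha> c (lambda_of f \<alpha> L0 b) = L0"
    using roots eq by simp_all
qed

end

section \<open>The shape of the parameter curve\<close>

theorem theorem3p7: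
  fixes f f' f'' :: "real \<Rightarrow> real" and \<alpha> L0 :: real
  assumes "\<And>u. (f has_real_derivative f' u) (at u)"
    and "\<And>u. (f' has_real_derivative f'' u) (at u)"
    and "continuous_on UNIV f''"
    and "\<And>u. f u > 0"
    and "\<And>u. f' u \<ge> 0"
    and "\<And>u. f'' u > 0"
    and "filterlim (\<lambda>u. f u / u) at_top at_top"
    and "\<alpha> > 0"
    and "L0 > 0"
  shows "\<exists>Cstar>0.
           strict_mono_on {0<..<Cstar} (lambda_of f \<alpha> L0) \<and>
           strict_antimono_on {Cstar<..} (lambda_of f \<alpha> L0) \<and>
           (lambda_of f \<alpha> L0 \<longlongrightarrow> 0) (at_right 0) \<and>
           (lambda_of f \<alpha> L0 \<longlongrightarrow> 0) at_top \<and>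
           lambda_of f \<alpha> L0 Cstar = lambda_star f \<alpha> L0"
proof -
  interpret robin_problem f f' f'' \<alpha> L0
    by unfold_locales (use assms in auto)
  obtain p where p: "p > 0" "strict_mono_on {0<..<p} (lambda_of f \<alpha> L0)"
    "strict_antimono_on {p<..} (lambda_of f \<alpha> L0)"
    "lambda_of f \<alpha> L0 ` {0<..} = {0<..lambda_of f \<alpha> L0 p}"
    by (rule unimodal_of_no_level_thrice[OF continuous_lambda_of lambda_of_root(1)
        lambda_of_at_0 lambda_of_at_top lambda_of_no_level_thrice])
  moreover have "lambda_star f \<alpha> L0 = lambda_of f \<alpha> L0 p"
    by (rule lambda_star_eq[OF p(4) lambda_of_root(1)[OF p(1)]])
  ultimately show ?thesis
    using lambda_of_at_0 lambda_of_at_top by (intro exI[of _ p]) simp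
qed

end
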